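(* Let $\Sigma$ be a well-formed LF signature, $\Gamma$ a context, and $\Theta$ the arity context induced by $\Sigma$ and $\Gamma$. If $\vdash\Gamma\ \mathrm{ctx}$ is derivable, then $\Gamma$ respects $\Theta$. If $\Gamma\vdash K\ \mathrm{kind}$ or $\Gamma\vdash A\ \mathrm{type}$ is derivable, then, respectively, $K$ or $A$ respects $\Theta$. If $\Gamma\vdash M\Leftarrow A$ is derivable, then $\Theta\vdash M:A^-$ is derivable. If $\Gamma\vdash R\Rightarrow A$ is derivable, then $\Theta\vdash R\Rightarrow A^-$ is derivable.
   Context: Canonical LF syntax: kinds $K::=\mathrm{Type}\mid\Pi x{:}A.K$; types $A::=P\mid\Pi x{:}A.B$; atomic types $P::=a\mid P\,M$; canonical terms $M::=R\mid\lambda x.M$; atomic terms $R::=c\mid x\mid R\,M$; signatures $\Sigma::=\cdot\mid\Sigma,c{:}A\mid\Sigma,a{:}K$; contexts $\Gamma::=\cdot\mid\Gamma,x{:}A$. Arity types: generated from $o$ by $\rightarrow$; erasure $P^-=o$, $(\Pi x{:}A_1.A_2)^-=A_1^-\rightarrow A_2^-$. Hereditary substitution $[\{\langle x,M,\alpha\rangle\}]E=E'$ replaces $x$ by $M$ in $E$ while normalizing any resulting $\beta$-redexes (indexed by the arity type $\alpha$). LF judgements (relative to fixed $\Sigma$, bound variables fresh for $\Gamma$): $\vdash\cdot\ \mathrm{ctx}$; $\vdash\Gamma,x{:}A\ \mathrm{ctx}$ if $\vdash\Gamma\ \mathrm{ctx}$, $\Gamma\vdash A\ \mathrm{type}$ and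 $x$ not in $\Gamma$. $\Gamma\vdash\mathrm{Type}\ \mathrm{kind}$; $\Gamma\vdash\Pi x{:}A.K\ \mathrm{kind}$ if $\Gamma\vdash A\ \mathrm{type}$ and $\Gamma,x{:}A\vdash K\ \mathrm{kind}$. $\Gamma\vdash P\ \mathrm{type}$ if $\Gamma\vdash P\Rightarrow\mathrm{Type}$; $\Gamma\vdash\Pi x{:}A_1.A_2\ \mathrm{type}$ if $\Gamma\vdash A_1\ \mathrm{type}$ and $\Gamma,x{:}A_1\vdash A_2\ \mathrm{type}$. $\Gamma\vdash a\Rightarrow K$ if $a{:}K\in\Sigma$; $\Gamma\vdash P\,M\Rightarrow K$ if $\Gamma\vdash P\Rightarrow\Pi x{:}A.K_1$, $\Gamma\vdash M\Leftarrow A$ and $[\{\langle x,M,A^-\rangle\}]K_1=K$. $\Gamma\vdash R\Leftarrow P$ if $\Gamma\vdash R\Rightarrow P$; $\Gamma\vdash\lambda x.M\Leftarrow\Pi x{:}A_1.A_2$ if $\Gamma,x{:}A_1\vdash M\Leftarrow A_2$. $\Gamma\vdash x\Rightarrow A$ if $x{:}A\in\Gamma$; $\Gamma\vdash c\Rightarrow A$ if $c{:}A\in\Sigma$; $\Gamma\vdash R\,M\Rightarrow A$ if $\Gamma\vdash R\Rightarrow\Pi x{:}A_1.A_2$, $\Gamma\vdash M\Leftarrow A_1$ and $[\{\langle x,M,A_1^-\rangle\}]A_2=A$. A signature is well-formed if its constants are distinct and each $c{:}A$ (resp. $a{:}K$) satisfies $\cdot\vdash A\ \mathrm{type}$ (resp.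 $\cdot\vdash K\ \mathrm{kind}$) relative to the preceding part. Arity contexts, arity typing and respecting: an arity context is a set of unique assignments of arity types to constants and variables; $\Theta_1\oplus\Theta_2$ is $\Theta_1$ plus assignments of $\Theta_2$ for unassigned symbols. $\Theta\vdash c\Rightarrow\alpha$, $\Theta\vdash x\Rightarrow\alpha$ if assigned; $\Theta\vdash R\,M\Rightarrow\alpha$ if $\Theta\vdash R\Rightarrow\alpha'\rightarrow\alpha$ and $\Theta\vdash M:\alpha'$; $\Theta\vdash\lambda x.M:\alpha_1\rightarrow\alpha_2$ if $\{x:\alpha_1\}\oplus\Theta\vdash M:\alpha_2$; $\Theta\vdash R:o$ if $\Theta\vdash R\Rightarrow o$. A kind/type respects $\Theta$ if it is $\mathrm{Type}$, or atomic with every canonical term in it arity-typable under $\Theta$, or $\Pi x{:}A.E'$ with $A$ respecting $\Theta$ and $E'$ respecting $\{x:A^-\}\oplus\Theta$; a context respects $\Theta$ if all its types do. The arity context induced by $\Sigma$ and $\Gamma$ contains $x:A^-$ for each $x{:}A\in\Gamma$ and $c:A^-$ for each $c{:}A\in\Sigma$. *)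

theory Defs
  imports Main
begin

text \<open>
  Canonical LF in locally nameless style.  Free variables carry names, bound variables are
  de Bruijn indices (constructor \<open>BVar\<close>), so that equality of expressions is equality up to
  renaming of bound variables.  A rule that descends below a binder opens the body with a
  fresh name: the body \<open>B\<close> of a binder that is displayed on paper as \<open>x. E\<close> is represented
  by \<open>B\<close> with \<open>open B x = E\<close> and \<open>x\<close> not free in \<open>B\<close>.  No rule applies to a dangling index.
\<close>

type_synonym vname = string
type_synonym cname = string

datatype atm = Const cname | FVar vname | BVar nat | App atm tm
  and tm = Atom atm | Lam tm

datatype aty = TConst cname | TApp aty tm

datatype ty = TAtom aty | Pi ty ty

datatype kind = Type | KPi ty kind

datatype decl = TmDecl cname ty | TyDecl cname kind

text \<open>Signatures and contexts are lists with the most recent declaration at the head.\<close>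

type_synonym sg = "decl list"
type_synonym ctx = "(vname \<times> ty) list"

primrec decl_name :: "decl \<Rightarrow> cname" where
  "decl_name (TmDecl c A) = c"
| "decl_name (TyDecl a K) = a"


section \<open>Free variables and opening\<close>

primrec fv_atm :: "atm \<Rightarrow> vname set" and fv_tm :: "tm \<Rightarrow> vname set" where
  "fv_atm (Const c) = {}"
| "fv_atm (FVar x) = {x}"
| "fv_atm (BVar i) = {}"
| "fv_atm (App R M) = fv_atm R \<union> fv_tm M"
| "fv_tm (Atom R) = fv_atm R"
| "fv_tm (Lam M) = fv_tm M"

primrec fv_aty :: "aty \<Rightarrow> vname set" where
  "fv_aty (TConst a) = {}"
| "fv_aty (TApp P M) = fv_aty P \<union> fv_tm M"

primrec fv_ty :: "ty \<Rightarrow> vname set" where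
  "fv_ty (TAtom P) = fv_aty P"
| "fv_ty (Pi A B) = fv_ty A \<union> fv_ty B"

primrec fv_kind :: "kind \<Rightarrow> vname set" where
  "fv_kind Type = {}"
| "fv_kind (KPi A K) = fv_ty A \<union> fv_kind K"

definition fv_ctx :: "ctx \<Rightarrow> vname set" where
  "fv_ctx \<Gamma> = (\<Union>(x, A) \<in> set \<Gamma>. insert x (fv_ty A))"

primrec open_atm_at :: "nat \<Rightarrow> vname \<Rightarrow> atm \<Rightarrow> atm"
  and open_tm_at :: "nat \<Rightarrow> vname \<Rightarrow> tm \<Rightarrow> tm" where
  "open_atm_at k x (Const c) = Const c"
| "open_atm_at k x (FVar y) = FVar y"
| "open_atm_at k x (BVar i) = (if i = k then FVar x else BVar i)"
| "open_atm_at k x (App R M) = App (open_atm_at k x R) (open_tm_at k x M)"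
| "open_tm_at k x (Atom R) = Atom (open_atm_at k x R)"
| "open_tm_at k x (Lam M) = Lam (open_tm_at (Suc k) x M)"

primrec open_aty_at :: "nat \<Rightarrow> vname \<Rightarrow> aty \<Rightarrow> aty" where
  "open_aty_at k x (TConst a) = TConst a"
| "open_aty_at k x (TApp P M) = TApp (open_aty_at k x P) (open_tm_at k x M)"

primrec open_ty_at :: "nat \<Rightarrow> vname \<Rightarrow> ty \<Rightarrow> ty" where
  "open_ty_at k x (TAtom P) = TAtom (open_aty_at k x P)"
| "open_ty_at k x (Pi A B) = Pi (open_ty_at k x A) (open_ty_at (Suc k) x B)"

primrec open_kind_at :: "nat \<Rightarrow> vname \<Rightarrow> kind \<Rightarrow> kind" where
  "open_kind_at k x Type = Type"
| "open_kind_at k x (KPi A K) = KPi (open_ty_at k x A) (open_kind_at (Suc k) x K)"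

abbreviation open_tm :: "tm \<Rightarrow> vname \<Rightarrow> tm" where "open_tm M x \<equiv> open_tm_at 0 x M"
abbreviation open_ty :: "ty \<Rightarrow> vname \<Rightarrow> ty" where "open_ty A x \<equiv> open_ty_at 0 x A"
abbreviation open_kind :: "kind \<Rightarrow> vname \<Rightarrow> kind" where "open_kind K x \<equiv> open_kind_at 0 x K"


section \<open>Arity types and erasure\<close>

datatype arity = Base | Arr arity arity  (infixr \<open>\<rightarrow>\<^sub>a\<close> 65)

primrec erase :: "ty \<Rightarrow> arity" where
  "erase (TAtom P) = Base"
| "erase (Pi A B) = erase A \<rightarrow>\<^sub>a erase B"


section \<open>Hereditary substitution\<close>

text \<open>
  \<open>hsub_tm x M \<alpha> E E'\<close> stands for \<open>[{\<langle>x, M, \<alpha>\<rangle>}]E = E'\<close>, and similarly for the other classes.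
  On an atomic term the result is either atomic (\<open>hsub_aa\<close>) or, if the head of the term is
  \<open>x\<close>, a canonical term together with an arity type (\<open>hsub_ac\<close>); in the latter case
  an application of the result is a redex, which is contracted by a further substitution
  at the argument arity type.
\<close>

inductive hsub_aa :: "vname \<Rightarrow> tm \<Rightarrow> arity \<Rightarrow> atm \<Rightarrow> atm \<Rightarrow> bool"
  and hsub_ac :: "vname \<Rightarrow> tm \<Rightarrow> arity \<Rightarrow> atm \<Rightarrow> tm \<Rightarrow> arity \<Rightarrow> bool"
  and hsub_tm :: "vname \<Rightarrow> tm \<Rightarrow> arity \<Rightarrow> tm \<Rightarrow> tm \<Rightarrow> bool"
where
  hsub_const: "hsub_aa x M \<alpha> (Const c) (Const c)"
| hsub_other: "y \<noteq> x \<Longrightarrow> hsub_aa x M \<alpha> (FVar y) (FVar y)"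
| hsub_app: "hsub_aa x M \<alpha> R R' \<Longrightarrow> hsub_tm x M \<alpha> N N' \<Longrightarrow>
    hsub_aa x M \<alpha> (App R N) (App R' N')"
| hsub_var: "hsub_ac x M \<alpha> (FVar x) M \<alpha>"
| hsub_beta: "hsub_ac x M \<alpha> R (Lam L) (\<alpha>\<^sub>1 \<rightarrow>\<^sub>a \<alpha>\<^sub>2) \<Longrightarrow> hsub_tm x M \<alpha> N N' \<Longrightarrow>
    y \<notin> fv_tm L \<union> fv_tm N' \<Longrightarrow> hsub_tm y N' \<alpha>\<^sub>1 (open_tm L y) L' \<Longrightarrow>
    hsub_ac x M \<alpha> (App R N) L' \<alpha>\<^sub>2"
| hsub_atom_a: "hsub_aa x M \<alpha> R R' \<Longrightarrow> hsub_tm x M \<alpha> (Atom R) (Atom R')"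
| hsub_atom_c: "hsub_ac x M \<alpha> R N \<beta> \<Longrightarrow> hsub_tm x M \<alpha> (Atom R) N"
| hsub_lam: "y \<notin> {x} \<union> fv_tm M \<union> fv_tm N \<union> fv_tm N' \<Longrightarrow>
    hsub_tm x M \<alpha> (open_tm N y) (open_tm N' y) \<Longrightarrow> hsub_tm x M \<alpha> (Lam N) (Lam N')"

inductive hsub_aty :: "vname \<Rightarrow> tm \<Rightarrow> arity \<Rightarrow> aty \<Rightarrow> aty \<Rightarrow> bool" for x M \<alpha> where
  hsub_tconst: "hsub_aty x M \<alpha> (TConst a) (TConst a)"
| hsub_tapp: "hsub_aty x M \<alpha> P P' \<Longrightarrow> hsub_tm x M \<alpha> N N' \<Longrightarrow>
    hsub_aty x M \<alpha> (TApp P N) (TApp P' N')"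

inductive hsub_ty :: "vname \<Rightarrow> tm \<Rightarrow> arity \<Rightarrow> ty \<Rightarrow> ty \<Rightarrow> bool" for x M \<alpha> where
  hsub_tatom: "hsub_aty x M \<alpha> P P' \<Longrightarrow> hsub_ty x M \<alpha> (TAtom P) (TAtom P')"
| hsub_pi: "hsub_ty x M \<alpha> A A' \<Longrightarrow> y \<notin> {x} \<union> fv_tm M \<union> fv_ty B \<union> fv_ty B' \<Longrightarrow>
    hsub_ty x M \<alpha> (open_ty B y) (open_ty B' y) \<Longrightarrow> hsub_ty x M \<alpha> (Pi A B) (Pi A' B')"

inductive hsub_kind :: "vname \<Rightarrow> tm \<Rightarrow> arity \<Rightarrow> kind \<Rightarrow> kind \<Rightarrow> bool" for x M \<alpha> where
  hsub_type: "hsub_kind x M \<alpha> Type Type"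
| hsub_kpi: "hsub_ty x M \<alpha> A A' \<Longrightarrow> y \<notin> {x} \<union> fv_tm M \<union> fv_kind K \<union> fv_kind K' \<Longrightarrow>
    hsub_kind x M \<alpha> (open_kind K y) (open_kind K' y) \<Longrightarrow>
    hsub_kind x M \<alpha> (KPi A K) (KPi A' K')"


section \<open>LF judgements\<close>

inductive wf_kind :: "sg \<Rightarrow> ctx \<Rightarrow> kind \<Rightarrow> bool"
  and wf_ty :: "sg \<Rightarrow> ctx \<Rightarrow> ty \<Rightarrow> bool"
  and synth_aty :: "sg \<Rightarrow> ctx \<Rightarrow> aty \<Rightarrow> kind \<Rightarrow> bool"
  and check :: "sg \<Rightarrow> ctx \<Rightarrow> tm \<Rightarrow> ty \<Rightarrow> bool"
  and synth :: "sg \<Rightarrow> ctx \<Rightarrow> atm \<Rightarrow> ty \<Rightarrow> bool"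
  for \<Sigma> :: sg
where
  wf_kind_type: "wf_kind \<Sigma> \<Gamma> Type"
| wf_kind_pi: "wf_ty \<Sigma> \<Gamma> A \<Longrightarrow> x \<notin> fv_ctx \<Gamma> \<union> fv_ty A \<union> fv_kind K \<Longrightarrow>
    wf_kind \<Sigma> ((x, A) # \<Gamma>) (open_kind K x) \<Longrightarrow> wf_kind \<Sigma> \<Gamma> (KPi A K)"
| wf_ty_atom: "synth_aty \<Sigma> \<Gamma> P Type \<Longrightarrow> wf_ty \<Sigma> \<Gamma> (TAtom P)"
| wf_ty_pi: "wf_ty \<Sigma> \<Gamma> A\<^sub>1 \<Longrightarrow> x \<notin> fv_ctx \<Gamma> \<union> fv_ty A\<^sub>1 \<union> fv_ty A\<^sub>2 \<Longrightarrow>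
    wf_ty \<Sigma> ((x, A\<^sub>1) # \<Gamma>) (open_ty A\<^sub>2 x) \<Longrightarrow> wf_ty \<Sigma> \<Gamma> (Pi A\<^sub>1 A\<^sub>2)"
| synth_tconst: "TyDecl a K \<in> set \<Sigma> \<Longrightarrow> synth_aty \<Sigma> \<Gamma> (TConst a) K"
| synth_tapp: "synth_aty \<Sigma> \<Gamma> P (KPi A K\<^sub>1) \<Longrightarrow> check \<Sigma> \<Gamma> M A \<Longrightarrow>
    x \<notin> fv_kind K\<^sub>1 \<union> fv_tm M \<Longrightarrow> hsub_kind x M (erase A) (open_kind K\<^sub>1 x) K \<Longrightarrow>
    synth_aty \<Sigma> \<Gamma> (TApp P M) K"
| check_atom: "synth \<Sigma> \<Gamma> R (TAtom P) \<Longrightarrow> check \<Sigma> \<Gamma> (Atom R) (TAtom P)"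
| check_lam: "x \<notin> fv_ctx \<Gamma> \<union> fv_ty A\<^sub>1 \<union> fv_ty A\<^sub>2 \<union> fv_tm M \<Longrightarrow>
    check \<Sigma> ((x, A\<^sub>1) # \<Gamma>) (open_tm M x) (open_ty A\<^sub>2 x) \<Longrightarrow>
    check \<Sigma> \<Gamma> (Lam M) (Pi A\<^sub>1 A\<^sub>2)"
| synth_var: "(x, A) \<in> set \<Gamma> \<Longrightarrow> synth \<Sigma> \<Gamma> (FVar x) A"
| synth_const: "TmDecl c A \<in> set \<Sigma> \<Longrightarrow> synth \<Sigma> \<Gamma> (Const c) A"
| synth_app: "synth \<Sigma> \<Gamma> R (Pi A\<^sub>1 A\<^sub>2) \<Longrightarrow> check \<Sigma> \<Gamma> M A\<^sub>1 \<Longrightarrow>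
    x \<notin> fv_ty A\<^sub>2 \<union> fv_tm M \<Longrightarrow> hsub_ty x M (erase A\<^sub>1) (open_ty A\<^sub>2 x) A \<Longrightarrow>
    synth \<Sigma> \<Gamma> (App R M) A"

inductive wf_ctx :: "sg \<Rightarrow> ctx \<Rightarrow> bool" for \<Sigma> :: sg where
  wf_ctx_nil: "wf_ctx \<Sigma> []"
| wf_ctx_cons: "wf_ctx \<Sigma> \<Gamma> \<Longrightarrow> wf_ty \<Sigma> \<Gamma> A \<Longrightarrow> x \<notin> fst ` set \<Gamma> \<Longrightarrow> wf_ctx \<Sigma> ((x, A) # \<Gamma>)"

inductive wf_sig :: "sg \<Rightarrow> bool" where
  wf_sig_nil: "wf_sig []"
| wf_sig_tm: "wf_sig \<Sigma> \<Longrightarrow> c \<notin> decl_name ` set \<Sigma> \<Longrightarrow> wf_ty \<Sigma> [] A \<Longrightarrow> wf_sig (TmDecl c A # \<Sigma>)"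
| wf_sig_ty: "wf_sig \<Sigma> \<Longrightarrow> a \<notin> decl_name ` set \<Sigma> \<Longrightarrow> wf_kind \<Sigma> [] K \<Longrightarrow> wf_sig (TyDecl a K # \<Sigma>)"


section \<open>Arity contexts, arity typing and respecting\<close>

datatype sym = SConst cname | SVar vname

text \<open>
  Uniqueness of the assignments in \<open>\<Theta>\<close> is \<open>single_valued \<Theta>\<close>.  It is not built into the type;
  the lemma at the end of the theory states when an induced arity context has it.
\<close>

type_synonym arity_ctx = "(sym \<times> arity) set"

definition arity_plus :: "arity_ctx \<Rightarrow> arity_ctx \<Rightarrow> arity_ctx"  (infixr \<open>\<oplus>\<close> 65) where
  "\<Theta>\<^sub>1 \<oplus> \<Theta>\<^sub>2 = \<Theta>\<^sub>1 \<union> {(s, \<alpha>) \<in> \<Theta>\<^sub>2. s \<notin> fst ` \<Theta>\<^sub>1}"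

inductive arity_synth :: "arity_ctx \<Rightarrow> atm \<Rightarrow> arity \<Rightarrow> bool"
  and arity_check :: "arity_ctx \<Rightarrow> tm \<Rightarrow> arity \<Rightarrow> bool"
where
  arity_const: "(SConst c, \<alpha>) \<in> \<Theta> \<Longrightarrow> arity_synth \<Theta> (Const c) \<alpha>"
| arity_var: "(SVar x, \<alpha>) \<in> \<Theta> \<Longrightarrow> arity_synth \<Theta> (FVar x) \<alpha>"
| arity_app: "arity_synth \<Theta> R (\<alpha>' \<rightarrow>\<^sub>a \<alpha>) \<Longrightarrow> arity_check \<Theta> M \<alpha>' \<Longrightarrow> arity_synth \<Theta> (App R M) \<alpha>"
| arity_lam: "x \<notin> fv_tm M \<Longrightarrow> arity_check ({(SVar x, \<alpha>\<^sub>1)} \<oplus> \<Theta>) (open_tm M x) \<alpha>\<^sub>2 \<Longrightarrow>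
    arity_check \<Theta> (Lam M) (\<alpha>\<^sub>1 \<rightarrow>\<^sub>a \<alpha>\<^sub>2)"
| arity_atom: "arity_synth \<Theta> R Base \<Longrightarrow> arity_check \<Theta> (Atom R) Base"

primrec aty_args :: "aty \<Rightarrow> tm set" where
  "aty_args (TConst a) = {}"
| "aty_args (TApp P M) = insert M (aty_args P)"

inductive respects_ty :: "arity_ctx \<Rightarrow> ty \<Rightarrow> bool" where
  respects_atom: "(\<And>M. M \<in> aty_args P \<Longrightarrow> \<exists>\<alpha>. arity_check \<Theta> M \<alpha>) \<Longrightarrow> respects_ty \<Theta> (TAtom P)"
| respects_pi: "respects_ty \<Theta> A \<Longrightarrow> x \<notin> fv_ty B \<Longrightarrow>
    respects_ty ({(SVar x, erase A)} \<oplus> \<Theta>) (open_ty B x) \<Longrightarrow> respects_ty \<Theta> (Pi A B)"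

inductive respects_kind :: "arity_ctx \<Rightarrow> kind \<Rightarrow> bool" where
  respects_type: "respects_kind \<Theta> Type"
| respects_kpi: "respects_ty \<Theta> A \<Longrightarrow> x \<notin> fv_kind K \<Longrightarrow>
    respects_kind ({(SVar x, erase A)} \<oplus> \<Theta>) (open_kind K x) \<Longrightarrow> respects_kind \<Theta> (KPi A K)"

definition respects_ctx :: "arity_ctx \<Rightarrow> ctx \<Rightarrow> bool" where
  "respects_ctx \<Theta> \<Gamma> \<longleftrightarrow> (\<forall>(x, A) \<in> set \<Gamma>. respects_ty \<Theta> A)"

definition induced_arity_ctx :: "sg \<Rightarrow> ctx \<Rightarrow> arity_ctx" where
  "induced_arity_ctx \<Sigma> \<Gamma> =
    {(SVar x, erase A) | x A. (x, A) \<in> set \<Gamma>} \<union> {(SConst c, erase A) | c A. TmDecl c A \<in> set \<Sigma>}"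

lemma wf_sig_unique:
  "wf_sig \<Sigma> \<Longrightarrow> TmDecl c A \<in> set \<Sigma> \<Longrightarrow> TmDecl c B \<in> set \<Sigma> \<Longrightarrow> A = B"
  by (induction rule: wf_sig.induct) (force simp: image_iff)+

lemma single_valued_induced_arity_ctx:
  assumes "wf_sig \<Sigma>" and "distinct (map fst \<Gamma>)"
  shows "single_valued (induced_arity_ctx \<Sigma> \<Gamma>)"
  using wf_sig_unique[OF assms(1)] eq_key_imp_eq_value[OF assms(2)]
  unfolding single_valued_def induced_arity_ctx_def by blast

end

theory Submission
  imports Defs
begin

text \<open>Erasure keeps only the \<open>Pi\<close> skeleton of a type, while opening and
  hereditary substitution change only terms inside atomic types. Dependent application thus becomes
  simple application after erasure (\<open>hsub_ty_erase\<close>), and extension by a fresh variable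
  becomes \<open>\<oplus>\<close> (\<open>induced_arity_ctx_Cons\<close>). Simultaneous induction on
  LF derivations then turns each rule into its arity counterpart; contexts follow by
  weakening.\<close>

lemma erase_open [simp]: "erase (open_ty_at k x A) = erase A"
  by (induction A arbitrary: k) auto

text \<open>Every atomic type erases to \<open>Base\<close> whatever its arguments; under
  \<open>Pi\<close>, \<open>erase_open\<close> discards the fresh name.\<close>

lemma hsub_ty_erase: "hsub_ty x M \<alpha> A A' \<Longrightarrow> erase A' = erase A"
  by (induction rule: hsub_ty.induct) auto

lemma arity_plus_mono: "\<Theta> \<subseteq> \<Theta>' \<Longrightarrow> \<Theta>\<^sub>1 \<oplus> \<Theta> \<subseteq> \<Theta>\<^sub>1 \<oplus> \<Theta>'"
  unfolding arity_plus_def by auto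

text \<open>Inclusion survives a binder because \<open>\<oplus>\<close> filters its right operand by
  the domain of the left one, which stays fixed.\<close>

lemma arity_weaken:
  shows "arity_synth \<Theta> R \<alpha> \<Longrightarrow> \<Theta> \<subseteq> \<Theta>' \<Longrightarrow> arity_synth \<Theta>' R \<alpha>"
    and "arity_check \<Theta> M \<beta> \<Longrightarrow> \<Theta> \<subseteq> \<Theta>' \<Longrightarrow> arity_check \<Theta>' M \<beta>"
proof (induction arbitrary: \<Theta>' and \<Theta>' rule: arity_synth_arity_check.inducts)
  case (arity_lam x M \<alpha>\<^sub>1 \<Theta> \<alpha>\<^sub>2)
  then show ?case
    by (metis arity_plus_mono arity_synth_arity_check.arity_lam)
qed (auto intro: arity_const arity_var arity_app arity_atom)

lemma respects_ty_weaken: "respects_ty \<Theta> A \<Longrightarrow> \<Theta> \<subseteq> \<Theta>' \<Longrightarrow> respects_ty \<Theta>' A"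
proof (induction arbitrary: \<Theta>' rule: respects_ty.induct)
  case (respects_atom P \<Theta>)
  then show ?case
    by (meson arity_weaken(2) respects_ty.respects_atom)
next
  case (respects_pi \<Theta> A x B)
  then show ?case
    by (meson arity_plus_mono respects_ty.respects_pi)
qed

lemma induced_arity_ctx_mono:
  "set \<Gamma> \<subseteq> set \<Gamma>' \<Longrightarrow> induced_arity_ctx \<Sigma> \<Gamma> \<subseteq> induced_arity_ctx \<Sigma> \<Gamma>'"
  unfolding induced_arity_ctx_def by blast

text \<open>Freshness makes the filter in \<open>\<oplus>\<close> vacuous: nothing is yet assigned
  to \<open>SVar x\<close>, and constants carry a different tag.\<close>

lemma induced_arity_ctx_Cons:
  assumes "x \<notin> fv_ctx \<Gamma>"
  shows "induced_arity_ctx \<Sigma> ((x, A) # \<Gamma>) = {(SVar x, erase A)} \<oplus> induced_arity_ctx \<Sigma> \<Gamma>"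
  using assms unfolding induced_arity_ctx_def arity_plus_def fv_ctx_def by auto

text \<open>The clause for \<open>synth_aty\<close>, absent from the theorem, carries the induction through atomic types.\<close>

lemma lf_respects_arity:
  shows "wf_kind \<Sigma> \<Gamma> K \<Longrightarrow> respects_kind (induced_arity_ctx \<Sigma> \<Gamma>) K"
    and "wf_ty \<Sigma> \<Gamma> A \<Longrightarrow> respects_ty (induced_arity_ctx \<Sigma> \<Gamma>) A"
    and "synth_aty \<Sigma> \<Gamma> P L \<Longrightarrow>
      \<forall>N \<in> aty_args P. \<exists>\<alpha>. arity_check (induced_arity_ctx \<Sigma> \<Gamma>) N \<alpha>"
    and "check \<Sigma> \<Gamma> M B \<Longrightarrow> arity_check (induced_arity_ctx \<Sigma> \<Gamma>) M (erase B)"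
    and "synth \<Sigma> \<Gamma> R C \<Longrightarrow> arity_synth (induced_arity_ctx \<Sigma> \<Gamma>) R (erase C)"
proof (induction rule: wf_kind_wf_ty_synth_aty_check_synth.inducts)
  case (synth_var x A \<Gamma>)
  then show ?case
    by (intro arity_var) (auto simp: induced_arity_ctx_def)
next
  case (synth_const c A \<Gamma>)
  then show ?case
    by (intro arity_const) (auto simp: induced_arity_ctx_def)
next
  case (synth_app \<Gamma> R A\<^sub>1 A\<^sub>2 M x A)
  \<comment> \<open>The result type comes from \<open>open_ty A\<^sub>2 x\<close> by substitution,
    so it erases to \<open>erase A\<^sub>2\<close>, the codomain given by the induction hypothesis
    for \<open>R\<close>.\<close>
  then show ?case
    by (auto simp: hsub_ty_erase intro: arity_app)
\<comment> \<open>In the binder cases the fresh name of the LF rule also serves as the witness in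
  the arity or respecting rule.\<close>
qed (auto simp: induced_arity_ctx_Cons
  intro: arity_atom arity_lam respects_ty.intros respects_kind.intros)

lemma wf_ctx_respects: "wf_ctx \<Sigma> \<Gamma> \<Longrightarrow> respects_ctx (induced_arity_ctx \<Sigma> \<Gamma>) \<Gamma>"
proof (induction rule: wf_ctx.induct)
  case wf_ctx_nil
  show ?case by (simp add: respects_ctx_def)
next
  case (wf_ctx_cons \<Gamma> A x)
  \<comment> \<open>Each type is known to respect only what the tail induces, whereas
    \<open>respects_ctx\<close> asks for the full context; this inclusion bridges the gap.\<close>
  have "induced_arity_ctx \<Sigma> \<Gamma> \<subseteq> induced_arity_ctx \<Sigma> ((x, A) # \<Gamma>)"
    by (rule induced_arity_ctx_mono) auto
  with wf_ctx_cons.IH lf_respects_arity(2)[OF wf_ctx_cons.hyps(2)] show ?case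
    by (auto simp: respects_ctx_def intro: respects_ty_weaken)
qed

theorem theorem2p13:
  fixes \<Sigma> :: sg and \<Gamma> :: ctx and \<Theta> :: arity_ctx
  assumes "wf_sig \<Sigma>" and "\<Theta> = induced_arity_ctx \<Sigma> \<Gamma>"
  shows "(wf_ctx \<Sigma> \<Gamma> \<longrightarrow> respects_ctx \<Theta> \<Gamma>) \<and>
    (\<forall>K. wf_kind \<Sigma> \<Gamma> K \<longrightarrow> respects_kind \<Theta> K) \<and>
    (\<forall>A. wf_ty \<Sigma> \<Gamma> A \<longrightarrow> respects_ty \<Theta> A) \<and>
    (\<forall>M A. check \<Sigma> \<Gamma> M A \<longrightarrow> arity_check \<Theta> M (erase A)) \<and>
    (\<forall>R A. synth \<Sigma> \<Gamma> R A \<longrightarrow> arity_synth \<Theta> R (erase A))"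
  unfolding assms(2) by (simp add: wf_ctx_respects lf_respects_arity)

end
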